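(* (1) For every finite involution poset $(P,\le,{}')$, the lattice $\mathcal O(P)$ becomes a distributive universe of separations $(\mathcal O(P),{}^* )$ when equipped with the involution ${}^*\colon X\mapsto P\setminus X'$, where $X'=\{x'\mid x\in X\}$. (2) Let $\vec U$ be a finite distributive universe of separations and let $P=\mathcal J(\vec U)$. Then there exists an order-reversing involution ${}'$ on $P$ such that the map $\eta\colon\vec U\to\mathcal O(P)$ defined by $\eta(a)=\{x\in P\mid x\le a\}$ is an isomorphism of universes of separations between $\vec U$ and $(\mathcal O(P),{}^* )$, where ${}^*\colon X\mapsto P\setminus\{x'\mid x\in X\}$.
   Context: An involution poset is a poset $(P,\le)$ with an order-reversing involution ${}'$. A universe of separations is a lattice equipped with an order-reversing involution ${}^*$; it is distributive if the lattice is distributive. An isomorphism of universes of separations is a bijection that preserves $\le$ (in both directions) and ${}^*$. For a poset $P$, $\mathcal O(P)$ is the lattice of down-closed subsets of $P$ ordered by inclusion, with union as join and intersection as meet. For a lattice $L$, $\mathcal J(L)$ is the set of join-irreducible elements of $L$, i.e. elements $x$ other than the bottom element such that $x=a\vee b$ with $a,b\in L$ implies $x\in\{a,b\}$; it carries the partial order inherited from $L$. *)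

theory Defs
  imports "HOL-Algebra.Lattice"
begin

definition order_reversing_involution :: "('a, 'c) gorder_scheme \<Rightarrow> ('a \<Rightarrow> 'a) \<Rightarrow> bool" where
  "order_reversing_involution L f \<longleftrightarrow>
     f \<in> carrier L \<rightarrow> carrier L \<and>
     (\<forall>x\<in>carrier L. f (f x) = x) \<and>
     (\<forall>x\<in>carrier L. \<forall>y\<in>carrier L. x \<sqsubseteq>\<^bsub>L\<^esub> y \<longrightarrow> f y \<sqsubseteq>\<^bsub>L\<^esub> f x)"

locale involution_poset = partial_order P for P (structure) +
  fixes invo :: "'a \<Rightarrow> 'a"
  assumes involution: "order_reversing_involution P invo"

text \<open>The library's locale \<^locale>\<open>lattice\<close> admits an empty carrier; a universe
  of separations is a lattice in the usual sense, hence nonempty.\<close>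

locale universe_of_separations = lattice U for U (structure) +
  fixes star :: "'a \<Rightarrow> 'a"
  assumes nonempty: "carrier U \<noteq> {}"
    and involution: "order_reversing_involution U star"

locale distributive_universe = universe_of_separations +
  assumes distributive:
    "\<lbrakk>x \<in> carrier U; y \<in> carrier U; z \<in> carrier U\<rbrakk> \<Longrightarrow> x \<sqinter> (y \<squnion> z) = (x \<sqinter> y) \<squnion> (x \<sqinter> z)"

definition universe_iso ::
  "('a, 'c) gorder_scheme \<Rightarrow> ('a \<Rightarrow> 'a) \<Rightarrow> ('b, 'd) gorder_scheme \<Rightarrow> ('b \<Rightarrow> 'b) \<Rightarrow> ('a \<Rightarrow> 'b) \<Rightarrow> bool"
  where
  "universe_iso U s V t f \<longleftrightarrow>
     universe_of_separations U s \<and> universe_of_separations V t \<and>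
     bij_betw f (carrier U) (carrier V) \<and>
     (\<forall>x\<in>carrier U. \<forall>y\<in>carrier U. x \<sqsubseteq>\<^bsub>U\<^esub> y \<longleftrightarrow> f x \<sqsubseteq>\<^bsub>V\<^esub> f y) \<and>
     (\<forall>x\<in>carrier U. f (s x) = t (f x))"

definition downsets :: "('a, 'c) gorder_scheme \<Rightarrow> 'a set set" where
  "downsets P = {X. X \<subseteq> carrier P \<and> (\<forall>x\<in>X. \<forall>y\<in>carrier P. y \<sqsubseteq>\<^bsub>P\<^esub> x \<longrightarrow> y \<in> X)}"

definition downset_lattice :: "('a, 'c) gorder_scheme \<Rightarrow> 'a set gorder" where
  "downset_lattice P = \<lparr>carrier = downsets P, eq = (=), le = (\<subseteq>)\<rparr>"

definition downset_star :: "('a, 'c) gorder_scheme \<Rightarrow> ('a \<Rightarrow> 'a) \<Rightarrow> 'a set \<Rightarrow> 'a set" where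
  "downset_star P invo X = carrier P - invo ` X"

text \<open>The bottom element is excluded through \<^const>\<open>least\<close>, since
  \<^const>\<open>bottom\<close> is an unspecified element in a lattice that has no least one.\<close>

definition join_irreducibles :: "('a, 'c) gorder_scheme \<Rightarrow> 'a set" where
  "join_irreducibles L =
     {x \<in> carrier L. \<not> least L x (carrier L) \<and>
        (\<forall>a\<in>carrier L. \<forall>b\<in>carrier L. x = a \<squnion>\<^bsub>L\<^esub> b \<longrightarrow> x \<in> {a, b})}"

definition join_irreducible_poset :: "('a, 'c) gorder_scheme \<Rightarrow> ('a, 'c) gorder_scheme" where
  "join_irreducible_poset L = L\<lparr>carrier := join_irreducibles L\<rparr>"

definition eta :: "('a, 'c) gorder_scheme \<Rightarrow> 'a \<Rightarrow> 'a set" where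
  "eta U a = {x \<in> join_irreducibles U. x \<sqsubseteq>\<^bsub>U\<^esub> a}"

lemma lattice_downset_lattice: "lattice (downset_lattice P)"
proof
  fix X Y assume XY: "X \<in> carrier (downset_lattice P)" "Y \<in> carrier (downset_lattice P)"
  show "\<exists>s. least (downset_lattice P) s (Upper (downset_lattice P) {X, Y})"
    by (rule exI[of _ "X \<union> Y"])
      (use XY in \<open>auto simp: least_def Upper_def downset_lattice_def downsets_def\<close>)
  show "\<exists>s. greatest (downset_lattice P) s (Lower (downset_lattice P) {X, Y})"
    by (rule exI[of _ "X \<inter> Y"])
      (use XY in \<open>auto simp: greatest_def Lower_def downset_lattice_def downsets_def\<close>)
qed (auto simp: downset_lattice_def)

lemma downset_lattice_join_meet:
  assumes "X \<in> downsets P" "Y \<in> downsets P"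
  shows "X \<squnion>\<^bsub>downset_lattice P\<^esub> Y = X \<union> Y" and "X \<sqinter>\<^bsub>downset_lattice P\<^esub> Y = X \<inter> Y"
proof -
  let ?L = "downset_lattice P"
  interpret L: lattice ?L by (rule lattice_downset_lattice)
  have "least ?L (X \<union> Y) (Upper ?L {X, Y})"
    using assms by (auto simp: least_def Upper_def downset_lattice_def downsets_def)
  then show "X \<squnion>\<^bsub>?L\<^esub> Y = X \<union> Y"
    unfolding join_def sup_def by (rule some_equality) (meson L.least_unique \<open>least ?L (X \<union> Y) _\<close>)
  have "greatest ?L (X \<inter> Y) (Lower ?L {X, Y})"
    using assms by (auto simp: greatest_def Lower_def downset_lattice_def downsets_def)
  then show "X \<sqinter>\<^bsub>?L\<^esub> Y = X \<inter> Y"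
    unfolding meet_def inf_def by (rule some_equality) (meson L.greatest_unique \<open>greatest ?L (X \<inter> Y) _\<close>)
qed

end

theory Submission
  imports Defs
begin

text \<open>In a finite distributive lattice a join-irreducible \<open>x\<close> is join-prime, so the elements not
  above \<open>x\<close> have a greatest member \<open>m x\<close>.  The involution on join-irreducibles is
  \<open>x' = (m x)\<^sup>*\<close>; equivalently, \<open>x' \<le> a\<^sup>*\<close> holds exactly when \<open>x \<le> a\<close> fails.
  Join-irreducibility of \<open>x'\<close>, \<open>x'' = x\<close>, antitonicity and the compatibility of \<open>\<eta>\<close> with the
  involutions all follow from this equivalence; that \<open>\<eta>\<close> is an order isomorphism is Birkhoff's theorem.\<close>

section \<open>Involutions and the universe of down-sets\<close>

context universe_of_separations
begin

lemma star_closed: "x \<in> carrier U \<Longrightarrow> star x \<in> carrier U"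
  and star_star: "x \<in> carrier U \<Longrightarrow> star (star x) = x"
  and star_antimono: "\<lbrakk>x \<sqsubseteq> y; x \<in> carrier U; y \<in> carrier U\<rbrakk> \<Longrightarrow> star y \<sqsubseteq> star x"
  using involution by (auto simp: order_reversing_involution_def)

end

text \<open>An antitone involution maps a down-set to an up-closed set, and the complement of an
  up-closed set is a down-set.\<close>

lemma downset_star_closed:
  assumes "order_reversing_involution P invo" "X \<in> downsets P"
  shows "downset_star P invo X \<in> downsets P"
proof -
  have "y \<notin> invo ` X"
    if z: "z \<in> carrier P" "z \<notin> invo ` X" and y: "y \<in> carrier P" "y \<sqsubseteq>\<^bsub>P\<^esub> z" for y z
  proof
    assume "y \<in> invo ` X"
    then obtain x where x: "x \<in> X" "y = invo x" by blast
    have xP: "x \<in> carrier P" using x assms(2) by (auto simp: downsets_def)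
    have "invo z \<sqsubseteq>\<^bsub>P\<^esub> invo y" "invo z \<in> carrier P" "invo (invo z) = z" "invo y = x"
      using assms(1) z y x xP by (auto simp: order_reversing_involution_def)
    then have "invo z \<in> X" using x assms(2) by (auto simp: downsets_def)
    with \<open>invo (invo z) = z\<close> z show False by force
  qed
  then show ?thesis by (auto simp: downset_star_def downsets_def)
qed

text \<open>Since \<open>invo\<close> is its own inverse, its images are preimages. This pointwise
  form serves both the involution law and the compatibility of \<open>eta\<close> with the
  involutions.\<close>

lemma mem_downset_star_iff:
  assumes "order_reversing_involution P invo" "X \<subseteq> carrier P" "z \<in> carrier P"
  shows "z \<in> downset_star P invo X \<longleftrightarrow> invo z \<notin> X"
proof -
  have "invo (invo x) = x" if "x \<in> carrier P" for x
    using assms(1) that by (simp add: order_reversing_involution_def)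
  then have "z \<in> invo ` X \<longleftrightarrow> invo z \<in> X"
    using assms(2,3) by (metis image_iff subset_iff)
  then show ?thesis using assms(3) by (simp add: downset_star_def)
qed

lemma order_reversing_involution_downset_star:
  assumes "order_reversing_involution P invo"
  shows "order_reversing_involution (downset_lattice P) (downset_star P invo)"
proof -
  have "downset_star P invo (downset_star P invo X) = X" if X: "X \<in> downsets P" for X
  proof -
    have "invo z \<in> carrier P" "invo (invo z) = z" if "z \<in> carrier P" for z
      using assms that by (auto simp: order_reversing_involution_def)
    moreover have "X \<subseteq> carrier P" "\<And>Y. downset_star P invo Y \<subseteq> carrier P"
      using X by (auto simp: downsets_def downset_star_def)
    \<comment> \<open>The membership criterion applied twice gives two negations and
      \<open>invo (invo z) = z\<close>.\<close>
    ultimately have "z \<in> downset_star P invo (downset_star P invo X) \<longleftrightarrow> z \<in> X"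
      if "z \<in> carrier P" for z
      using that by (simp add: mem_downset_star_iff[OF assms])
    with \<open>X \<subseteq> carrier P\<close> show ?thesis by (auto simp: downset_star_def)
  qed
  then show ?thesis
    using downset_star_closed[OF assms]
    by (auto simp: order_reversing_involution_def downset_lattice_def downset_star_def)
qed

lemma distributive_universe_downset_lattice:
  assumes "order_reversing_involution P invo"
  shows "distributive_universe (downset_lattice P) (downset_star P invo)"
proof -
  interpret lattice "downset_lattice P" by (rule lattice_downset_lattice)
  have [simp]: "carrier (downset_lattice P) = downsets P" by (simp add: downset_lattice_def)
  show ?thesis
  proof
    show "carrier (downset_lattice P) \<noteq> {}" by (auto simp: downsets_def)
    show "order_reversing_involution (downset_lattice P) (downset_star P invo)"
      using assms by (rule order_reversing_involution_downset_star)
  next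
    fix X Y Z
    assume "X \<in> carrier (downset_lattice P)" "Y \<in> carrier (downset_lattice P)"
      "Z \<in> carrier (downset_lattice P)"
    \<comment> \<open>\<open>downset_lattice_join_meet\<close> rewrites joins and meets of down-sets
      only, so the inner terms must be down-sets too.\<close>
    moreover from this have "Y \<union> Z \<in> downsets P" "X \<inter> Y \<in> downsets P" "X \<inter> Z \<in> downsets P"
      by (auto simp: downsets_def)
    ultimately show "X \<sqinter>\<^bsub>downset_lattice P\<^esub> (Y \<squnion>\<^bsub>downset_lattice P\<^esub> Z) =
      X \<sqinter>\<^bsub>downset_lattice P\<^esub> Y \<squnion>\<^bsub>downset_lattice P\<^esub> (X \<sqinter>\<^bsub>downset_lattice P\<^esub> Z)"
      by (simp add: downset_lattice_join_meet Int_Un_distrib)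
  qed
qed

section \<open>Extremal elements and separation by join-irreducibles in finite lattices\<close>

lemma (in lattice) finite_join_closed_has_greatest:
  assumes "finite S" "S \<noteq> {}" "S \<subseteq> carrier L"
    and join: "\<And>a b. a \<in> S \<Longrightarrow> b \<in> S \<Longrightarrow> a \<squnion> b \<in> S"
  obtains m where "m \<in> S" "\<And>a. a \<in> S \<Longrightarrow> a \<sqsubseteq> m"
proof -
  \<comment> \<open>Only \<open>T\<close> grows in the induction, while the bound stays in
    \<open>S\<close>; taking \<open>T = S\<close> yields the greatest element.\<close>
  have "\<exists>m\<in>S. \<forall>a\<in>T. a \<sqsubseteq> m" if "finite T" "T \<subseteq> S" for T
    using that
  proof (induction T rule: finite_induct)
    case empty
    then show ?case using assms(2) by auto
  next
    case (insert x T)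
    then obtain m where m: "m \<in> S" "\<forall>a\<in>T. a \<sqsubseteq> m" by auto
    have "x \<sqsubseteq> x \<squnion> m" "m \<sqsubseteq> x \<squnion> m"
      using insert.prems m(1) assms(3) by (auto intro: join_left join_right)
    moreover have "a \<sqsubseteq> x \<squnion> m" if "a \<in> T" for a
      using that m insert.prems assms(3) \<open>m \<sqsubseteq> x \<squnion> m\<close> join
      by (meson insert_subset le_trans subset_iff)
    ultimately show ?case using join m(1) insert.prems by blast
  qed
  from this[OF assms(1) order_refl] show thesis using that by blast
qed

lemma (in partial_order) finite_has_minimal_element:
  assumes "finite S" "S \<noteq> {}" "S \<subseteq> carrier L"
  obtains m where "m \<in> S" "\<And>a. a \<in> S \<Longrightarrow> a \<sqsubseteq> m \<Longrightarrow> a = m"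
proof -
  \<comment> \<open>\<open>bex_min_element\<close> is applied to the strict part of the order, which
    is asymmetric and transitive.\<close>
  have "\<exists>m\<in>S. \<forall>a\<in>S. a \<noteq> m \<longrightarrow> \<not> (a \<sqsubseteq> m \<and> a \<noteq> m)"
    using assms
    by (intro Finite_Set.bex_min_element asymp_onI transp_onI)
      (auto intro: le_trans)
  then show thesis using that by blast
qed

text \<open>A minimal element \<open>z\<close> is least, because
  \<open>z \<sqinter> a \<sqsubseteq> z\<close> forces \<open>z \<sqinter> a = z\<close>.\<close>

lemma (in lattice) finite_has_least:
  assumes "finite (carrier L)" "carrier L \<noteq> {}"
  obtains z where "z \<in> carrier L" "\<And>a. a \<in> carrier L \<Longrightarrow> z \<sqsubseteq> a"
proof -
  obtain z where z: "z \<in> carrier L" "\<And>a. a \<in> carrier L \<Longrightarrow> a \<sqsubseteq> z \<Longrightarrow> a = z"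
    using finite_has_minimal_element[OF assms order_refl] by blast
  have "z \<sqsubseteq> a" if "a \<in> carrier L" for a
    using z that meet_left meet_right meet_closed by metis
  with z show thesis using that by blast
qed

text \<open>If \<open>a \<sqsubseteq> b\<close> fails, a minimal \<open>c\<close> below
  \<open>a\<close> but not below \<open>b\<close> is join-irreducible: were \<open>c\<close> the
  join of two elements other than \<open>c\<close>, both would lie below \<open>b\<close> by
  minimality, and so would \<open>c\<close>. Hence \<open>c\<close> separates \<open>eta L a\<close>
  from \<open>eta L b\<close>.\<close>

lemma (in lattice) eta_subset_iff:
  assumes "finite (carrier L)" "a \<in> carrier L" "b \<in> carrier L"
  shows "eta L a \<subseteq> eta L b \<longleftrightarrow> a \<sqsubseteq> b"
proof
  assume "a \<sqsubseteq> b"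
  then show "eta L a \<subseteq> eta L b"
    using assms by (auto simp: eta_def join_irreducibles_def intro: le_trans)
next
  assume sub: "eta L a \<subseteq> eta L b"
  show "a \<sqsubseteq> b"
  proof (rule ccontr)
    assume nle: "\<not> a \<sqsubseteq> b"
    let ?S = "{c \<in> carrier L. c \<sqsubseteq> a \<and> \<not> c \<sqsubseteq> b}"
    have "?S \<noteq> {}" using nle assms by auto
    then obtain c where "c \<in> ?S" and min: "\<And>d. d \<in> ?S \<Longrightarrow> d \<sqsubseteq> c \<Longrightarrow> d = c"
      using finite_has_minimal_element[of ?S] assms(1) by auto
    then have c: "c \<in> carrier L" "c \<sqsubseteq> a" "\<not> c \<sqsubseteq> b" by auto
    have "c \<in> {d, e}" if de: "d \<in> carrier L" "e \<in> carrier L" "c = d \<squnion> e" for d e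
    proof (rule ccontr)
      assume "c \<notin> {d, e}"
      moreover have "d \<sqsubseteq> c" "e \<sqsubseteq> c" using de by (auto intro: join_left join_right)
      moreover from this have "d \<sqsubseteq> a" "e \<sqsubseteq> a" using c de(1,2) assms(2) by (meson le_trans)+
      ultimately have "d \<sqsubseteq> b" "e \<sqsubseteq> b" using min de(1,2) by blast+
      then show False using c de assms(3) by (auto intro: join_le)
    qed
    moreover have "\<not> least L c (carrier L)" using c assms(3) by (auto simp: least_def)
    ultimately have "c \<in> eta L a" using c by (auto simp: eta_def join_irreducibles_def)
    with sub c show False by (auto simp: eta_def)
  qed
qed

lemma join_irreducibles_carrier: "x \<in> join_irreducibles L \<Longrightarrow> x \<in> carrier L"
  by (simp add: join_irreducibles_def)

lemma join_irreducible_poset_simps [simp]: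
  "carrier (join_irreducible_poset L) = join_irreducibles L"
  "le (join_irreducible_poset L) = le L"
  "eq (join_irreducible_poset L) = eq L"
  by (simp_all add: join_irreducible_poset_def)

lemma (in partial_order) partial_order_join_irreducible_poset:
  "partial_order (join_irreducible_poset L)"
  by unfold_locales
    (auto simp: eq_is_equal intro: le_trans dest: join_irreducibles_carrier)

section \<open>Birkhoff representation of a finite distributive lattice\<close>

context distributive_universe
begin

text \<open>Join-irreducibles are join-prime: distributivity splits
  \<open>x = x \<sqinter> (a \<squnion> b)\<close> into a join of two meets, and \<open>x\<close>
  must equal one of them.\<close>

lemma join_irreducible_le_join_iff:
  assumes "x \<in> join_irreducibles U" "a \<in> carrier U" "b \<in> carrier U"
  shows "x \<sqsubseteq> a \<squnion> b \<longleftrightarrow> x \<sqsubseteq> a \<or> x \<sqsubseteq> b"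
proof
  have x: "x \<in> carrier U" using assms(1) by (rule join_irreducibles_carrier)
  assume "x \<sqsubseteq> a \<squnion> b"
  then have "x = x \<sqinter> (a \<squnion> b)"
    using x assms
    by (metis join_closed le_iff_join)
  then have "x = (x \<sqinter> a) \<squnion> (x \<sqinter> b)" using distributive x assms by simp
  then have "x = x \<sqinter> a \<or> x = x \<sqinter> b"
    using assms x by (simp add: join_irreducibles_def) (metis meet_closed)
  then show "x \<sqsubseteq> a \<or> x \<sqsubseteq> b" using x assms meet_right by metis
next
  assume "x \<sqsubseteq> a \<or> x \<sqsubseteq> b"
  then show "x \<sqsubseteq> a \<squnion> b"
    using join_irreducibles_carrier[OF assms(1)] assms
    by (meson join_closed join_left join_right le_trans)
qed

text \<open>The witness is the join of \<open>X\<close>, built one element at a time; join-primeness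
  handles each step. This supplies preimages under \<open>eta\<close>.\<close>

lemma finite_join_irreducible_le:
  assumes "finite (carrier U)" "finite X" "X \<subseteq> carrier U"
  shows "\<exists>a\<in>carrier U. \<forall>x\<in>join_irreducibles U. x \<sqsubseteq> a \<longleftrightarrow> (\<exists>y\<in>X. x \<sqsubseteq> y)"
  using assms(2,3)
proof (induction X rule: finite_induct)
  case empty
  \<comment> \<open>The empty join is the least element, and no join-irreducible lies below
    it.\<close>
  obtain z where z: "z \<in> carrier U" "\<And>a. a \<in> carrier U \<Longrightarrow> z \<sqsubseteq> a"
    using finite_has_least[OF assms(1) nonempty] by blast
  have "\<not> x \<sqsubseteq> z" if "x \<in> join_irreducibles U" for x
  proof
    assume "x \<sqsubseteq> z"
    then have "x = z" using z that join_irreducibles_carrier by (metis le_antisym)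
    then show False using z that by (auto simp: join_irreducibles_def least_def)
  qed
  with z(1) show ?case by auto
next
  case (insert y X)
  then obtain a where "a \<in> carrier U" "\<forall>x\<in>join_irreducibles U. x \<sqsubseteq> a \<longleftrightarrow> (\<exists>y\<in>X. x \<sqsubseteq> y)"
    by auto
  then show ?case
    using insert.prems by (intro bexI[of _ "y \<squnion> a"]) (auto simp: join_irreducible_le_join_iff)
qed

lemma bij_betw_eta:
  assumes "finite (carrier U)"
  shows "bij_betw (eta U) (carrier U) (downsets (join_irreducible_poset U))"
  unfolding bij_betw_def
proof
  show "inj_on (eta U) (carrier U)"
    using eta_subset_iff[OF assms] by (metis inj_onI le_antisym order_refl)
  have "X \<in> eta U ` carrier U" if X: "X \<in> downsets (join_irreducible_poset U)" for X
  proof -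
    have XJ: "X \<subseteq> join_irreducibles U" using X by (simp add: downsets_def)
    then have "X \<subseteq> carrier U" by (auto dest: join_irreducibles_carrier)
    then obtain a where a: "a \<in> carrier U"
      "\<forall>x\<in>join_irreducibles U. x \<sqsubseteq> a \<longleftrightarrow> (\<exists>y\<in>X. x \<sqsubseteq> y)"
      using finite_join_irreducible_le[OF assms] assms finite_subset by metis
    have "eta U a = {x \<in> join_irreducibles U. \<exists>y\<in>X. x \<sqsubseteq> y}" using a by (auto simp: eta_def)
    \<comment> \<open>One inclusion is down-closure of \<open>X\<close>, the other is
      reflexivity.\<close>
    also have "\<dots> = X"
      using X XJ \<open>X \<subseteq> carrier U\<close> by (fastforce simp: downsets_def)
    finally show ?thesis using a(1) by blast
  qed
  moreover have "eta U a \<in> downsets (join_irreducible_poset U)" if "a \<in> carrier U" for a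
    using that by (auto simp: eta_def downsets_def intro: le_trans dest: join_irreducibles_carrier)
  ultimately show "eta U ` carrier U = downsets (join_irreducible_poset U)" by blast
qed

section \<open>The involution on join-irreducible elements\<close>

definition dual_irreducible :: "'a \<Rightarrow> 'a \<Rightarrow> bool" where
  "dual_irreducible x x' \<longleftrightarrow> x' \<in> carrier U \<and> (\<forall>a\<in>carrier U. x' \<sqsubseteq> star a \<longleftrightarrow> \<not> x \<sqsubseteq> a)"

lemma dual_irreducible_exists:
  assumes "finite (carrier U)" and xJ: "x \<in> join_irreducibles U"
  obtains x' where "dual_irreducible x x'"
proof -
  let ?S = "{a \<in> carrier U. \<not> x \<sqsubseteq> a}"
  have x: "x \<in> carrier U" using xJ by (rule join_irreducibles_carrier)
  \<comment> \<open>\<open>?S\<close> is nonempty because \<open>x\<close> is not the least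
    element.\<close>
  have "finite ?S" "?S \<noteq> {}" "?S \<subseteq> carrier U"
    using assms(1) xJ by (auto simp: join_irreducibles_def least_def)
  moreover have "a \<squnion> b \<in> ?S" if "a \<in> ?S" "b \<in> ?S" for a b
    using that by (simp add: join_irreducible_le_join_iff[OF xJ])
  ultimately obtain m where "m \<in> ?S" and max: "\<And>a. a \<in> ?S \<Longrightarrow> a \<sqsubseteq> m"
    by (rule finite_join_closed_has_greatest) blast+
  then have m: "m \<in> carrier U" "\<not> x \<sqsubseteq> m" by auto
  have "star m \<sqsubseteq> star a \<longleftrightarrow> \<not> x \<sqsubseteq> a" if "a \<in> carrier U" for a
  proof -
    have "star m \<sqsubseteq> star a \<longleftrightarrow> a \<sqsubseteq> m"
      using that m(1) star_antimono star_closed star_star by metis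
    also have "\<dots> \<longleftrightarrow> \<not> x \<sqsubseteq> a" using that m x max le_trans by blast
    finally show ?thesis .
  qed
  then show thesis using that[of "star m"] m(1) by (simp add: dual_irreducible_def star_closed)
qed

text \<open>Substituting \<open>star a\<close> for \<open>a\<close> in the definition lets
  \<open>x'\<close> be compared with an arbitrary element.\<close>

lemma dual_irreducible_le_iff:
  assumes "dual_irreducible x x'" "a \<in> carrier U"
  shows "x' \<sqsubseteq> a \<longleftrightarrow> \<not> x \<sqsubseteq> star a"
  using assms star_closed star_star by (metis dual_irreducible_def)

text \<open>Any \<open>b\<close> not above \<open>x'\<close> satisfies
  \<open>x \<sqsubseteq> star b\<close>, that is, \<open>b \<sqsubseteq> star x\<close>. Two such
  elements have their join below \<open>star x\<close>, whereas \<open>x'\<close> is not below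
  \<open>star x\<close>.\<close>

lemma dual_irreducible_join_irreducible:
  assumes xx': "dual_irreducible x x'" and x: "x \<in> carrier U"
  shows "x' \<in> join_irreducibles U"
proof -
  note iff = dual_irreducible_le_iff[OF xx']
  have x': "x' \<in> carrier U" using xx' by (simp add: dual_irreducible_def)
  have "\<not> x' \<sqsubseteq> star x" using iff x by (simp add: star_closed star_star)
  then have "\<not> least U x' (carrier U)" using star_closed[OF x] by (auto simp: least_def)
  moreover have "x' \<in> {b, c}" if bc: "b \<in> carrier U" "c \<in> carrier U" "x' = b \<squnion> c" for b c
  proof (rule ccontr)
    assume "x' \<notin> {b, c}"
    moreover have "b \<sqsubseteq> x'" "c \<sqsubseteq> x'" using bc by (auto intro: join_left join_right)
    ultimately have "\<not> x' \<sqsubseteq> b" "\<not> x' \<sqsubseteq> c" using bc(1,2) x' le_antisym by blast+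
    then have le: "b \<sqsubseteq> star x" "c \<sqsubseteq> star x"
      using iff bc(1,2) x star_antimono star_closed star_star by metis+
    then have "x' \<sqsubseteq> star x" using bc x star_closed by (auto intro: join_le)
    with \<open>\<not> x' \<sqsubseteq> star x\<close> show False ..
  qed
  ultimately show ?thesis using x' by (auto simp: join_irreducibles_def)
qed

text \<open>Passing through \<open>x'\<close> negates twice, so \<open>x''\<close> and
  \<open>x\<close> lie below the same elements; antisymmetry then identifies them.\<close>

lemma dual_irreducible_dual_eq:
  assumes "dual_irreducible x x'" "dual_irreducible x' x''" "x \<in> carrier U"
  shows "x'' = x"
proof -
  have x'': "x'' \<in> carrier U" using assms(2) by (simp add: dual_irreducible_def)
  have "x'' \<sqsubseteq> a \<longleftrightarrow> x \<sqsubseteq> a" if "a \<in> carrier U" for a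
    using that assms(1,2) star_closed star_star by (metis dual_irreducible_def dual_irreducible_le_iff)
  then show ?thesis using x'' assms(3) by (metis le_antisym le_refl)
qed

lemma dual_irreducible_antimono:
  assumes "dual_irreducible x x'" "dual_irreducible y y'" "x \<sqsubseteq> y" "x \<in> carrier U" "y \<in> carrier U"
  shows "y' \<sqsubseteq> x'"
proof -
  have x': "x' \<in> carrier U" using assms(1) by (simp add: dual_irreducible_def)
  \<comment> \<open>Testing \<open>x'\<close> against itself: \<open>x' \<sqsubseteq> x'\<close>
    holds, so \<open>x \<sqsubseteq> star x'\<close> fails.\<close>
  then have "\<not> x \<sqsubseteq> star x'" using dual_irreducible_le_iff[OF assms(1)] by auto
  then have "\<not> y \<sqsubseteq> star x'" using assms x' star_closed le_trans by metis
  then show ?thesis using dual_irreducible_le_iff[OF assms(2)] x' by auto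
qed

text \<open>A choice function for \<open>dual_irreducible\<close> is the involution. The relation is
  exported as well, since it is what ties \<open>invo\<close> to \<open>star\<close>.\<close>

lemma join_irreducible_involution_exists:
  assumes "finite (carrier U)"
  obtains invo where "involution_poset (join_irreducible_poset U) invo"
    and "\<And>x. x \<in> join_irreducibles U \<Longrightarrow> dual_irreducible x (invo x)"
proof -
  have "\<forall>x\<in>join_irreducibles U. \<exists>x'. dual_irreducible x x'"
    using dual_irreducible_exists[OF assms] by blast
  then obtain invo where invo: "\<And>x. x \<in> join_irreducibles U \<Longrightarrow> dual_irreducible x (invo x)"
    by metis
  have closed: "invo x \<in> join_irreducibles U" if "x \<in> join_irreducibles U" for x
    using invo that dual_irreducible_join_irreducible join_irreducibles_carrier by metis
  have "order_reversing_involution (join_irreducible_poset U) invo"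
    unfolding order_reversing_involution_def join_irreducible_poset_simps
  proof (intro conjI ballI impI)
    show "invo \<in> join_irreducibles U \<rightarrow> join_irreducibles U" using closed by blast
    show "invo (invo x) = x" if "x \<in> join_irreducibles U" for x
      using that by (intro dual_irreducible_dual_eq[of x "invo x"] invo closed join_irreducibles_carrier)
    show "invo y \<sqsubseteq> invo x"
      if "x \<in> join_irreducibles U" "y \<in> join_irreducibles U" "x \<sqsubseteq> y" for x y
      using that by (blast intro: dual_irreducible_antimono[OF invo invo] join_irreducibles_carrier)
  qed
  then have "involution_poset (join_irreducible_poset U) invo"
    by (simp add: involution_poset_def involution_poset_axioms_def partial_order_join_irreducible_poset)
  then show thesis using that invo by blast
qed

text \<open>For join-irreducible \<open>z\<close>, \<open>z \<sqsubseteq> star a\<close> holds iff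
  \<open>invo z \<sqsubseteq> a\<close> fails, which is membership in the complement of the image of
  \<open>eta U a\<close>. The order part is Birkhoff's theorem.\<close>

lemma universe_iso_eta:
  assumes fin: "finite (carrier U)"
    and P: "involution_poset (join_irreducible_poset U) invo"
    and invo: "\<And>x. x \<in> join_irreducibles U \<Longrightarrow> dual_irreducible x (invo x)"
  shows "universe_iso U star (downset_lattice (join_irreducible_poset U))
    (downset_star (join_irreducible_poset U) invo) (eta U)"
proof -
  let ?P = "join_irreducible_poset U"
  have ori: "order_reversing_involution ?P invo"
    using P by (rule involution_poset.involution)
  have "eta U (star a) = downset_star ?P invo (eta U a)" if a: "a \<in> carrier U" for a
  proof (rule Set.set_eqI)
    fix z
    show "z \<in> eta U (star a) \<longleftrightarrow> z \<in> downset_star ?P invo (eta U a)"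
    proof (cases "z \<in> join_irreducibles U")
      case True
      then have "invo z \<in> join_irreducibles U"
        using ori by (auto simp: order_reversing_involution_def)
      moreover have "eta U a \<subseteq> carrier ?P" by (auto simp: eta_def)
      ultimately show ?thesis
        using mem_downset_star_iff[OF ori, of "eta U a" z] True
          dual_irreducible_le_iff[OF invo[OF True] a]
        by (simp add: eta_def)
    \<comment> \<open>Both sides contain join-irreducibles only.\<close>
    qed (simp add: eta_def downset_star_def)
  qed
  moreover have "universe_of_separations (downset_lattice ?P) (downset_star ?P invo)"
    using distributive_universe_downset_lattice[OF ori] by (rule distributive_universe.axioms)
  ultimately show ?thesis
    using bij_betw_eta[OF fin] eta_subset_iff[OF fin] universe_of_separations_axioms
    by (simp add: universe_iso_def downset_lattice_def)
qed

end

theorem theorem6p2: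
  shows "(\<forall>(P :: 'a gorder) invo.
            finite (carrier P) \<and> involution_poset P invo \<longrightarrow>
            distributive_universe (downset_lattice P) (downset_star P invo)) \<and>
         (\<forall>(U :: 'b gorder) star.
            finite (carrier U) \<and> distributive_universe U star \<longrightarrow>
            (\<exists>invo. involution_poset (join_irreducible_poset U) invo \<and>
               universe_iso U star
                 (downset_lattice (join_irreducible_poset U))
                 (downset_star (join_irreducible_poset U) invo)
                 (eta U)))"
proof (intro conjI allI impI; elim conjE)
  fix P :: "'a gorder" and invo
  assume "involution_poset P invo"
  then show "distributive_universe (downset_lattice P) (downset_star P invo)"
    by (intro distributive_universe_downset_lattice involution_poset.involution)
next
  fix U :: "'b gorder" and star
  assume "finite (carrier U)" "distributive_universe U star"
  then show "\<exists>invo. involution_poset (join_irreducible_poset U) invo \<and>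
    universe_iso U star (downset_lattice (join_irreducible_poset U))
      (downset_star (join_irreducible_poset U) invo) (eta U)"
    by (metis distributive_universe.join_irreducible_involution_exists
        distributive_universe.universe_iso_eta)
qed

end
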